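(* Let $E$ be a finite set and let $S,S'\subseteq 2^E$ be powerful sets. If $S$ and $S'$ have the same set of minimal nonempty members (with respect to inclusion), then $S=S'$. That is, every powerful set is determined by its clutter of minimal nonempty members.
   Context: For a finite ground set $E$, a family $S\subseteq 2^E$ is called a powerful set if for every $X\subseteq E$ the number of members $Y\in S$ with $Y\cap X=\emptyset$ is a power of $2$. The minimal nonempty members of $S$ are those nonempty $Y\in S$ such that no nonempty proper subset of $Y$ belongs to $S$. *)

theory Defs
  imports Main
begin

definition powerful_set :: "'a set \<Rightarrow> 'a set set \<Rightarrow> bool" where
  "powerful_set E S \<longleftrightarrow>
     S \<subseteq> Pow E \<and> (\<forall>X\<subseteq>E. \<exists>k::nat. card {Y \<in> S. Y \<inter> X = {}} = 2 ^ k)"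

definition minimal_nonempty_members :: "'a set set \<Rightarrow> 'a set set" where
  "minimal_nonempty_members S =
     {Y \<in> S. Y \<noteq> {} \<and> \<not> (\<exists>Z\<in>S. Z \<noteq> {} \<and> Z \<subset> Y)}"

end

theory Submission
  imports Defs
begin

text \<open>
  Taking complements, \<open>S\<close> is powerful iff every \<open>A \<subseteq> E\<close> contains a power-of-two number of members
  of \<open>S\<close>. Decide membership of \<open>A\<close> by induction on inclusion: if \<open>n\<close> members of \<open>S\<close> lie properly
  below \<open>A\<close>, then \<open>n\<close> or \<open>n + 1\<close> is a power of two according to whether \<open>A \<notin> S\<close> or \<open>A \<in> S\<close>, and
  both are only if \<open>n = 1\<close>. In that case \<open>{}\<close> is the only member properly below \<open>A\<close>, so \<open>A \<in> S\<close>
  iff \<open>A\<close> is a minimal nonempty member.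
\<close>

text \<open>Parity: for positive \<open>k\<close> the left side is odd, and the only odd power of
  two is 1, which is too small.\<close>

lemma power_of_two_Suc_eq_power_of_two:
  fixes k l :: nat
  assumes "Suc (2 ^ k) = 2 ^ l"
  shows "k = 0"
proof (rule ccontr)
  assume "k \<noteq> 0"
  then have "odd ((2::nat) ^ l)"
    unfolding assms[symmetric] by simp
  then have "l = 0"
    by simp
  with assms show False
    by simp
qed

lemma powerful_set_card_subsets:
  assumes "powerful_set E S" "A \<subseteq> E"
  shows "\<exists>k::nat. card {Y \<in> S. Y \<subseteq> A} = 2 ^ k"
proof -
  have "{Y \<in> S. Y \<subseteq> A} = {Y \<in> S. Y \<inter> (E - A) = {}}"
    using assms unfolding powerful_set_def by blast
  moreover have "E - A \<subseteq> E"
    by blast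
  ultimately show ?thesis
    using assms(1) unfolding powerful_set_def by simp
qed

text \<open>The count of members inside \<open>{}\<close> is a power of two, hence not 0.\<close>

lemma powerful_set_empty_mem:
  assumes "powerful_set E S"
  shows "{} \<in> S"
proof (rule ccontr)
  assume "{} \<notin> S"
  then have "card {Y \<in> S. Y \<subseteq> {}} = 0"
    by (auto simp: card_eq_0_iff)
  moreover obtain k :: nat where "card {Y \<in> S. Y \<subseteq> {}} = 2 ^ k"
    using powerful_set_card_subsets[OF assms] by blast
  ultimately have "(2::nat) ^ k = 0"
    by (simp only:)
  then show False
    by simp
qed

text \<open>One direction of the induction step; the other follows by swapping \<open>S\<close> and
  \<open>S'\<close>.\<close>

lemma powerful_set_mem_transfer:
  assumes "finite E" "powerful_set E S" "powerful_set E S'"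
    and minimal: "minimal_nonempty_members S = minimal_nonempty_members S'"
    and below: "{Y \<in> S. Y \<subset> A} = {Y \<in> S'. Y \<subset> A}"
    and "A \<in> S"
  shows "A \<in> S'"
proof (rule ccontr)
  assume "A \<notin> S'"
  have "A \<subseteq> E" and fin: "finite {Y \<in> S. Y \<subset> A}"
    using assms(1,2) \<open>A \<in> S\<close> unfolding powerful_set_def
    by (auto intro: finite_subset[of _ "Pow E"])
  obtain k l :: nat where k: "card {Y \<in> S'. Y \<subseteq> A} = 2 ^ k" and l: "card {Y \<in> S. Y \<subseteq> A} = 2 ^ l"
    using powerful_set_card_subsets assms(2,3) \<open>A \<subseteq> E\<close> by metis
  \<comment> \<open>The power of two counted in \<open>S'\<close> thus reappears in \<open>S\<close>
    as the count strictly below \<open>A\<close>.\<close>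
  have "{Y \<in> S'. Y \<subseteq> A} = {Y \<in> S. Y \<subset> A}"
    using below \<open>A \<notin> S'\<close> by auto
  then have n: "card {Y \<in> S. Y \<subset> A} = 2 ^ k"
    using k by simp
  have "{Y \<in> S. Y \<subseteq> A} = insert A {Y \<in> S. Y \<subset> A}"
    using \<open>A \<in> S\<close> by auto
  then have "Suc (2 ^ k) = 2 ^ l"
    using fin l n by simp
  then have "card {Y \<in> S. Y \<subset> A} = 1"
    using n power_of_two_Suc_eq_power_of_two by simp
  moreover have "A \<noteq> {}"
    using powerful_set_empty_mem[OF assms(3)] \<open>A \<notin> S'\<close> by auto
  then have "{} \<in> {Y \<in> S. Y \<subset> A}"
    using powerful_set_empty_mem[OF assms(2)] by auto
  ultimately have "{Y \<in> S. Y \<subset> A} = {{}}"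
    by (metis card_1_singletonE singletonD)
  then have "A \<in> minimal_nonempty_members S"
    using \<open>A \<in> S\<close> \<open>A \<noteq> {}\<close> unfolding minimal_nonempty_members_def by blast
  then have "A \<in> minimal_nonempty_members S'"
    by (simp only: minimal)
  then show False
    using \<open>A \<notin> S'\<close> unfolding minimal_nonempty_members_def by simp
qed

theorem theorem12:
  fixes E :: "'a set" and S S' :: "'a set set"
  assumes "finite E"
    and "powerful_set E S"
    and "powerful_set E S'"
    and "minimal_nonempty_members S = minimal_nonempty_members S'"
  shows "S = S'"
proof -
  \<comment> \<open>No \<open>A \<subseteq> E\<close> is needed here: the transfer lemma derives it
    from membership.\<close>
  have "A \<in> S \<longleftrightarrow> A \<in> S'" if "finite A" for A
    using that
  proof (induction A rule: finite_psubset_induct)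
    case (psubset A)
    then have below: "{Y \<in> S. Y \<subset> A} = {Y \<in> S'. Y \<subset> A}"
      by blast
    show ?case
      using powerful_set_mem_transfer[OF assms below]
        powerful_set_mem_transfer[OF assms(1,3,2) assms(4)[symmetric] below[symmetric]]
      by blast
  qed
  moreover have "finite A" if "A \<in> S \<union> S'" for A
  proof -
    have "A \<subseteq> E"
      using that assms(2,3) unfolding powerful_set_def by auto
    then show ?thesis
      using assms(1) finite_subset by auto
  qed
  ultimately show ?thesis
    by blast
qed

end
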